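(* Let $\kappa<\lambda$ be cardinals where $\kappa$ is a strong limit cardinal, $\mathrm{cf}(\lambda)>\kappa$, and $2^{<\lambda}=\lambda$. Let $U$ be a fine, $\sigma$-complete ultrafilter on $P_\kappa(\lambda)$. Then $\lnot\mathrm{Gal}(U,\kappa,2^\lambda)$.
   Context: $P_\kappa(\lambda)=\{x\subseteq\lambda : |x|<\kappa\}$. An ultrafilter $U$ on $P_\kappa(\lambda)$ is fine if $\{x\in P_\kappa(\lambda):\alpha\in x\}\in U$ for every $\alpha<\lambda$; it is $\sigma$-complete if it is closed under countable intersections. For a filter $F$ and cardinals $\mu\le\nu$, $\mathrm{Gal}(F,\mu,\nu)$ means: for every sequence $\langle A_i:i<\nu\rangle$ of sets in $F$ there is $I\subseteq\nu$ with $|I|=\mu$ such that $\bigcap_{i\in I}A_i\in F$. *)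

theory Defs
  imports Main "HOL-Library.Countable_Set"
begin

unbundle cardinal_syntax

text \<open>
  Cardinals are the cardinal orders of the library: relations \<open>r\<close> with \<open>Card_order r\<close>, compared by
  \<open><o\<close>, \<open>\<le>o\<close>, \<open>=o\<close>. The set of ordinals below the cardinal \<open>r\<close> is \<open>Field r\<close>.
\<close>

subsection \<open>Least elements and suprema of sets of cardinals, cofinality, strong limits\<close>

definition least_card :: "'a rel set \<Rightarrow> 'a rel" where
  "least_card C = (SOME c. c \<in> C \<and> (\<forall>d\<in>C. c \<le>o d))"

text \<open>
  The supremum is sought among the cardinals of the type \<open>'a rel\<close> that the members of \<open>C\<close> have.
  By \<open>card_sup_upper\<close> and \<open>card_sup_least\<close> below it exists there and is the least upper bound
  among the cardinals of all types.
\<close>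
definition card_sup :: "'a rel set \<Rightarrow> 'a rel" where
  "card_sup C = least_card {c. Card_order c \<and> (\<forall>r\<in>C. r \<le>o c)}"

text \<open>
  The library's \<open>cofinal A r\<close> asks for strict bounds, so that cofinal sets exist only if \<open>r\<close> has no
  last element; this is the case for every infinite cardinal, where it means unboundedness.
\<close>
definition cofinality :: "'a rel \<Rightarrow> 'a rel" where
  "cofinality r = least_card {|A| | A. A \<subseteq> Field r \<and> cofinal A r}"

text \<open>The cardinal $2^{<r}$, the supremum of all $2^m$ with $m < r$.\<close>
definition two_pow_less :: "'a rel \<Rightarrow> ('a \<Rightarrow> bool) rel" where
  "two_pow_less r = card_sup {ctwo ^c m | m :: 'a rel. Card_order m \<and> m <o r}"

definition strong_limit :: "'a rel \<Rightarrow> bool" where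
  "strong_limit r \<longleftrightarrow> Card_order r \<and> cinfinite r \<and>
     (\<forall>m :: 'a rel. Card_order m \<and> m <o r \<longrightarrow> ctwo ^c m <o r)"

lemma least_card:
  assumes "C \<noteq> {}" "\<And>c. c \<in> C \<Longrightarrow> Card_order c"
  shows "least_card C \<in> C" "\<And>d. d \<in> C \<Longrightarrow> least_card C \<le>o d"
proof -
  have "\<exists>c. c \<in> C \<and> (\<forall>d\<in>C. c \<le>o d)"
    using exists_minim_Card_order[of C] assms by blast
  from someI_ex[OF this] show "least_card C \<in> C" "\<And>d. d \<in> C \<Longrightarrow> least_card C \<le>o d"
    unfolding least_card_def by blast+
qed

lemma ordLeq_imp_same_type:
  fixes c :: "'a rel" and d :: "'b rel"
  assumes "Card_order d" "d \<le>o c"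
  obtains d' :: "'a rel" where "Card_order d'" "d' =o d"
proof -
  have "|Field d| =o d" using assms(1) by (rule card_of_Field_ordIso)
  moreover have "|Field d| \<le>o |Field c|"
    using assms(2) by (rule card_of_mono2)
  then obtain f where f: "inj_on f (Field d)" "f ` Field d \<subseteq> Field c"
    by (auto simp: card_of_ordLeq[symmetric])
  have "|f ` Field d| =o |Field d|"
    using f(1) by (metis card_of_ordIsoI inj_on_imp_bij_betw ordIso_symmetric)
  ultimately have "|f ` Field d| =o d" by (blast intro: ordIso_transitive)
  then show thesis using that card_of_Card_order by blast
qed

lemma card_sup:
  fixes C :: "'a rel set"
  assumes "\<And>c. c \<in> C \<Longrightarrow> Card_order c"
  shows Card_order_card_sup: "Card_order (card_sup C)"
    and card_sup_upper: "\<And>c. c \<in> C \<Longrightarrow> c \<le>o card_sup C"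
    and card_sup_least: "\<And>d :: 'b rel. Card_order d \<Longrightarrow> (\<And>c. c \<in> C \<Longrightarrow> c \<le>o d) \<Longrightarrow> card_sup C \<le>o d"
proof -
  let ?B = "{c :: 'a rel. Card_order c \<and> (\<forall>r\<in>C. r \<le>o c)}"
  have "r \<le>o |UNIV :: 'a set|" if "r \<in> C" for r
  proof -
    have "r =o |Field r|" using assms that card_of_Field_ordIso ordIso_symmetric by blast
    moreover have "|Field r| \<le>o |UNIV :: 'a set|" by (simp add: card_of_mono1)
    ultimately show ?thesis by (rule ordIso_ordLeq_trans)
  qed
  then have "|UNIV :: 'a set| \<in> ?B" using card_of_Card_order by blast
  then have ne: "?B \<noteq> {}" by blast
  have B: "card_sup C \<in> ?B" "\<And>d. d \<in> ?B \<Longrightarrow> card_sup C \<le>o d"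
    unfolding card_sup_def by (rule least_card[OF ne]; blast)+
  show "Card_order (card_sup C)" "\<And>c. c \<in> C \<Longrightarrow> c \<le>o card_sup C"
    using B(1) by blast+
  show "card_sup C \<le>o d" if d: "Card_order d" "\<And>c. c \<in> C \<Longrightarrow> c \<le>o d" for d :: "'b rel"
  proof (cases "card_sup C \<le>o d")
    case False
    then have "d \<le>o card_sup C"
      using ordLeq_total[of d "card_sup C"] d(1) B(1) by (auto simp: card_order_on_well_order_on)
    then obtain d' :: "'a rel" where d': "Card_order d'" "d' =o d"
      using ordLeq_imp_same_type d(1) by blast
    then have "d' \<in> ?B" using d(2) ordIso_symmetric ordLeq_ordIso_trans by blast
    then show ?thesis using B(2) d'(2) ordLeq_ordIso_trans by blast
  qed
qed

lemma cofinality: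
  assumes "Card_order r" "cinfinite r"
  shows cofinality_witness: "\<exists>A. A \<subseteq> Field r \<and> cofinal A r \<and> cofinality r = |A|"
    and cofinality_least: "\<And>A. A \<subseteq> Field r \<Longrightarrow> cofinal A r \<Longrightarrow> cofinality r \<le>o |A|"
proof -
  let ?C = "{|A| | A. A \<subseteq> Field r \<and> cofinal A r}"
  have "cofinal (Field r) r"
    unfolding cofinal_def using infinite_Card_order_limit[OF assms(1)] assms(2)
    by (metis cinfinite_def)
  then have ne: "?C \<noteq> {}" by blast
  have C: "cofinality r \<in> ?C" "\<And>d. d \<in> ?C \<Longrightarrow> cofinality r \<le>o d"
    unfolding cofinality_def by (rule least_card[OF ne]; force simp: card_of_Card_order)+
  show "\<exists>A. A \<subseteq> Field r \<and> cofinal A r \<and> cofinality r = |A|" using C(1) by blast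
  show "\<And>A. A \<subseteq> Field r \<Longrightarrow> cofinal A r \<Longrightarrow> cofinality r \<le>o |A|" using C(2) by blast
qed

subsection \<open>Filters on \<open>P\<^sub>\<kappa>(\<lambda>)\<close>\<close>

definition P_card :: "'k rel \<Rightarrow> 'l rel \<Rightarrow> 'l set set" where
  "P_card k l = {x. x \<subseteq> Field l \<and> |x| <o k}"

text \<open>
  A filter on a set \<open>X\<close> is a library filter \<open>F\<close> with \<open>F \<le> principal X\<close>, i.e. one that contains \<open>X\<close>;
  a set \<open>A\<close> belongs to it iff \<open>eventually (\<lambda>x. x \<in> A) F\<close>. Membership of \<open>A\<close> depends only on \<open>A \<inter> X\<close>,
  so the filter is determined by its members that are subsets of \<open>X\<close>.
\<close>
definition ultrafilter_on :: "'a set \<Rightarrow> 'a filter \<Rightarrow> bool" where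
  "ultrafilter_on X U \<longleftrightarrow> U \<le> principal X \<and> U \<noteq> bot \<and>
     (\<forall>A \<subseteq> X. eventually (\<lambda>x. x \<in> A) U \<or> eventually (\<lambda>x. x \<in> X - A) U)"

definition fine :: "'k rel \<Rightarrow> 'l rel \<Rightarrow> 'l set filter \<Rightarrow> bool" where
  "fine k l U \<longleftrightarrow> (\<forall>a \<in> Field l. eventually (\<lambda>x. x \<in> {x \<in> P_card k l. a \<in> x}) U)"

definition sigma_complete :: "'a filter \<Rightarrow> bool" where
  "sigma_complete U \<longleftrightarrow>
     (\<forall>S. countable S \<and> (\<forall>A\<in>S. eventually (\<lambda>x. x \<in> A) U) \<longrightarrow> eventually (\<lambda>x. x \<in> \<Inter>S) U)"

definition Gal :: "'a filter \<Rightarrow> 'm rel \<Rightarrow> 'n rel \<Rightarrow> bool" where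
  "Gal F m n \<longleftrightarrow>
     (\<forall>A :: 'n \<Rightarrow> 'a set. (\<forall>i \<in> Field n. eventually (\<lambda>x. x \<in> A i) F) \<longrightarrow>
        (\<exists>I \<subseteq> Field n. |I| =o m \<and> eventually (\<lambda>x. x \<in> (\<Inter>i\<in>I. A i)) F))"

end

theory Submission
  imports Defs
begin

text \<open>
  Code all pairs of a level \<open>\<beta> < \<lambda>\<close> and a subset of \<open>\<beta>\<close> by elements of \<open>\<lambda>\<close>, using
  \<open>2\<^bsup><\<lambda>\<^esup> = \<lambda>\<close>. By \<open>\<sigma>\<close>-completeness the functions into \<open>\<lambda>\<close> are well-founded modulo \<open>U\<close>, so
  there is a least function \<open>\<delta>\<close> that lies almost everywhere above every constant; in the
  ultrapower it represents \<open>sup j[\<lambda>]\<close>. For \<open>f \<subseteq> \<lambda>\<close> let \<open>A\<^sub>f\<close> be the set of those \<open>x\<close> that contain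
  codes of initial segments of \<open>f\<close> at levels cofinal in \<open>\<delta>(x)\<close>. Fineness and minimality of \<open>\<delta>\<close>
  give \<open>A\<^sub>f \<in> U\<close>. If \<open>x \<in> A\<^sub>f\<close>, then \<open>f \<inter> \<delta>(x)\<close> is determined by the set of codes of its initial
  segments in \<open>x\<close>, so there are at most \<open>2\<^bsup>|x|\<^esup> < \<kappa>\<close> such traces; but \<open>\<kappa>\<close> many sets \<open>f\<close> already
  differ below a common level as \<open>cf(\<lambda>) > \<kappa>\<close>, and almost every \<open>\<delta>(x)\<close> is above that level.
\<close>

text \<open>A descending chain modulo \<open>U\<close> involves countably many sets in
  \<open>U\<close>. Any point of their intersection carries a descending chain of \<open>r\<close>
  itself.\<close>

lemma wf_eventually:
  assumes "sigma_complete U" "U \<noteq> bot" "wf r"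
  shows "wf {(g, h). eventually (\<lambda>x. (g x, h x) \<in> r) U}"
  unfolding wf_iff_no_infinite_down_chain
proof
  assume "\<exists>h. \<forall>i. (h (Suc i), h i) \<in> {(g, h). eventually (\<lambda>x. (g x, h x) \<in> r) U}"
  then obtain h where h: "\<And>i :: nat. eventually (\<lambda>x. (h (Suc i) x, h i x) \<in> r) U" by blast
  let ?S = "range (\<lambda>i. {x. (h (Suc i) x, h i x) \<in> r})"
  have "eventually (\<lambda>x. x \<in> \<Inter>?S) U"
    using assms(1) h unfolding sigma_complete_def by (elim allE[of _ ?S]) auto
  then obtain x where "\<And>i. (h (Suc i) x, h i x) \<in> r"
    using eventually_happens[of _ U] assms(2) by fastforce
  then have "\<exists>f. \<forall>i. (f (Suc i), f i) \<in> r" by (intro exI[of _ "\<lambda>i. h i x"]) simp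
  then show False using assms(3) unfolding wf_iff_no_infinite_down_chain by blast
qed

lemma ultrafilter_on_dichotomy:
  assumes "ultrafilter_on X U"
  shows "eventually P U \<or> eventually (\<lambda>x. \<not> P x) U"
proof -
  have "{x \<in> X. P x} \<subseteq> X" by blast
  then have "eventually (\<lambda>x. x \<in> {x \<in> X. P x}) U \<or>
      eventually (\<lambda>x. x \<in> X - {x \<in> X. P x}) U"
    using assms unfolding ultrafilter_on_def by blast
  then show ?thesis
  proof
    assume "eventually (\<lambda>x. x \<in> {x \<in> X. P x}) U"
    then show ?thesis by (intro disjI1) (rule eventually_mono, blast+)
  next
    assume "eventually (\<lambda>x. x \<in> X - {x \<in> X. P x}) U"
    then show ?thesis by (intro disjI2) (rule eventually_mono, blast+)
  qed
qed

lemma Well_order_strict_trans: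
  assumes "Well_order r" "(a, b) \<in> r" "(b, c) \<in> r - Id"
  shows "(a, c) \<in> r - Id"
proof -
  have "trans r" "antisym r" using assms(1) unfolding order_on_defs by blast+
  then show ?thesis using assms(2,3) by (auto dest: transD antisymD)
qed

lemma ordLess_cofinality_bounded:
  assumes "Card_order r" "cinfinite r" "A \<subseteq> Field r" "|A| <o cofinality r"
  shows "\<exists>b\<in>Field r. \<forall>a\<in>A. (a, b) \<in> r - Id"
proof -
  have "\<not> cofinality r \<le>o |A|" using assms(4) not_ordLess_ordLeq by blast
  then have "\<not> cofinal A r" using cofinality_least[OF assms(1-3)] by blast
  then obtain b where b: "b \<in> Field r" "\<forall>a\<in>A. a = b \<or> (b, a) \<notin> r"
    unfolding cofinal_def by metis
  have wo: "Well_order r" using assms(1) by (rule card_order_on_well_order_on)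
  then have "(a, b) \<in> r" if "a \<in> A" for a
    using b assms(3) that unfolding order_on_defs total_on_def refl_on_def by (metis subsetD)
  \<comment> \<open>So far \<open>b\<close> is only a weak bound. An infinite cardinal is a limit,
    so a larger \<open>b'\<close> makes it strict.\<close>
  moreover obtain b' where "b' \<in> Field r" "(b, b') \<in> r - Id"
    using infinite_Card_order_limit[OF assms(1)] assms(2) b(1) unfolding cinfinite_def by blast
  ultimately show ?thesis using Well_order_strict_trans[OF wo] by blast
qed

lemma strong_limit_card_of_Pow:
  fixes k :: "'k rel" and x :: "'a set"
  assumes "strong_limit k" "|x| <o k"
  shows "|Pow x| <o k"
proof -
  \<comment> \<open>\<open>strong_limit\<close> quantifies only over cardinals of type
    \<open>'k rel\<close>, so \<open>|x|\<close> is first copied into that type.\<close>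
  obtain m :: "'k rel" where m: "Card_order m" "m =o |x|"
    using ordLeq_imp_same_type[of "|x|" k] assms(2) card_of_Card_order ordLess_imp_ordLeq by blast
  have "ctwo ^c m <o k"
    using assms m ordIso_ordLess_trans unfolding strong_limit_def by blast
  moreover have "|Pow x| =o ctwo ^c |x|"
    using card_of_Pow_Func[of x] by (simp add: cexp_def ctwo_def Field_card_of)
  moreover have "ctwo ^c |x| =o ctwo ^c m"
    using m by (intro cexp_cong2 Card_order_ctwo card_of_Card_order) (auto intro: ordIso_symmetric)
  ultimately show ?thesis by (meson ordIso_ordLess_trans)
qed

text \<open>Proper initial segments are smaller than \<open>l\<close>, so each fibre has size at
  most \<open>two_pow_less l\<close>, and there are \<open>l\<close> many fibres.\<close>

lemma card_of_bounded_subsets: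
  fixes l :: "'l rel"
  assumes "Card_order l" "cinfinite l" "two_pow_less l \<le>o l"
  shows "|SIGMA b:Field l. Pow (underS l b)| \<le>o l"
proof -
  have "|Pow (underS l b)| \<le>o l" if "b \<in> Field l" for b
  proof -
    have "|underS l b| <o l" using card_of_underS[OF assms(1) that] .
    then have "ctwo ^c |underS l b| \<le>o two_pow_less l"
      unfolding two_pow_less_def
      by (intro card_sup_upper) (auto intro: card_of_Card_order Card_order_cexp)
    moreover have "|Pow (underS l b)| =o ctwo ^c |underS l b|"
      using card_of_Pow_Func[of "underS l b"] by (simp add: cexp_def ctwo_def Field_card_of)
    ultimately show ?thesis using assms(3) ordIso_ordLeq_trans ordLeq_transitive by blast
  qed
  then show ?thesis
    using assms by (intro card_of_Sigma_ordLeq_infinite_Field)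
      (auto simp: cinfinite_def intro: card_of_Field_ordIso ordIso_imp_ordLeq)
qed

text \<open>The function \<open>e\<close> shows that dominating functions exist, and
  well-foundedness modulo \<open>U\<close> yields a minimal one. Anything below it fails to dominate
  some constant \<open>a\<close>, hence is at most \<open>a\<close> almost everywhere.\<close>

lemma least_dominating_function:
  fixes l :: "'l rel"
  assumes "Well_order l" "ultrafilter_on X U" "sigma_complete U"
    and "\<And>a. a \<in> Field l \<Longrightarrow> eventually (\<lambda>x. (a, e x) \<in> l - Id) U"
  obtains d where "\<And>a. a \<in> Field l \<Longrightarrow> eventually (\<lambda>x. (a, d x) \<in> l - Id) U"
    and "\<And>h. eventually (\<lambda>x. (h x, d x) \<in> l - Id) U \<Longrightarrow>
           \<exists>a\<in>Field l. eventually (\<lambda>x. (h x, a) \<in> l) U"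
proof -
  let ?D = "{d. \<forall>a\<in>Field l. eventually (\<lambda>x. (a, d x) \<in> l - Id) U}"
  have "wf (l - Id)" using assms(1) unfolding well_order_on_def by blast
  then have wf: "wf {(g, h). eventually (\<lambda>x. (g x, h x) \<in> l - Id) U}"
    using wf_eventually assms(2,3) unfolding ultrafilter_on_def by blast
  have "e \<in> ?D" using assms(4) by simp
  from wf[unfolded wf_eq_minimal, THEN spec, THEN spec, THEN mp, OF this]
  obtain d where d: "d \<in> ?D"
    and min: "\<forall>h. (h, d) \<in> {(g, h). eventually (\<lambda>x. (g x, h x) \<in> l - Id) U} \<longrightarrow> h \<notin> ?D"
    by (elim bexE)
  have "refl_on (Field l) l" "total_on (Field l) l"
    using assms(1) unfolding order_on_defs by blast+
  then have tot: "(y, x) \<in> l" if "x \<in> Field l" "y \<in> Field l" "(x, y) \<notin> l - Id" for x y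
    using that by (cases "x = y") (auto simp: refl_on_def total_on_def)
  show thesis
  proof (rule that[of d])
    show "eventually (\<lambda>x. (a, d x) \<in> l - Id) U" if "a \<in> Field l" for a using d that by blast
    show "\<exists>a\<in>Field l. eventually (\<lambda>x. (h x, a) \<in> l) U"
      if h: "eventually (\<lambda>x. (h x, d x) \<in> l - Id) U" for h
    proof -
      obtain a where a: "a \<in> Field l" "\<not> eventually (\<lambda>x. (a, h x) \<in> l - Id) U"
        using min h by auto
      then have "eventually (\<lambda>x. (a, h x) \<notin> l - Id) U"
        using ultrafilter_on_dichotomy[OF assms(2)] by blast
      with h have "eventually (\<lambda>x. (h x, a) \<in> l) U"
      proof eventually_elim
        case (elim x)
        then have "h x \<in> Field l" by (auto intro: FieldI1)
        then show ?case using tot a(1) elim(2) by blast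
      qed
      then show ?thesis using a(1) by blast
    qed
  qed
qed

theorem theorem2p7:
  fixes k :: "'k rel" and l :: "'l rel" and U :: "'l set filter"
  assumes "Card_order k" and "Card_order l" and "k <o l"
    and "strong_limit k"
    and "k <o cofinality l"
    and "two_pow_less l =o l"
    and "ultrafilter_on (P_card k l) U"
    and "fine k l U"
    and "sigma_complete U"
  shows "\<not> Gal U k (ctwo ^c l)"
proof
  assume gal: "Gal U k (ctwo ^c l)"
  have k_inf: "cinfinite k" using assms(4) unfolding strong_limit_def by blast
  then have l_inf: "cinfinite l"
    using cinfinite_mono[OF ordLess_imp_ordLeq[OF assms(3)]] by blast
  have wo: "Well_order l" using assms(2) by (rule card_order_on_well_order_on)
  have U: "U \<noteq> bot" "eventually (\<lambda>x. x \<in> P_card k l) U"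
    using assms(7) by (auto simp: ultrafilter_on_def le_principal)
  have fine: "eventually (\<lambda>x. a \<in> x) U" if "a \<in> Field l" for a
    using assms(8) that unfolding fine_def by (auto elim: eventually_mono)

  have "\<exists>b. \<forall>a\<in>x. (a, b) \<in> l - Id" if "x \<in> P_card k l" for x
  proof -
    have "x \<subseteq> Field l" "|x| <o cofinality l"
      using that assms(5) ordLess_transitive unfolding P_card_def by blast+
    from ordLess_cofinality_bounded[OF assms(2) l_inf this] show ?thesis by auto
  qed
  then obtain e where e: "\<forall>x\<in>P_card k l. \<forall>a\<in>x. (a, e x) \<in> l - Id"
    using bchoice[of "P_card k l" "\<lambda>x b. \<forall>a\<in>x. (a, b) \<in> l - Id"] by blast
  have "eventually (\<lambda>x. (a, e x) \<in> l - Id) U" if "a \<in> Field l" for a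
    using fine[OF that] U(2) by eventually_elim (use e in blast)
  then obtain d where d: "\<And>a. a \<in> Field l \<Longrightarrow> eventually (\<lambda>x. (a, d x) \<in> l - Id) U"
    and d_min: "\<And>h. eventually (\<lambda>x. (h x, d x) \<in> l - Id) U \<Longrightarrow>
           \<exists>a\<in>Field l. eventually (\<lambda>x. (h x, a) \<in> l) U"
    using least_dominating_function[OF wo assms(7,9), of e] by blast

  have "|SIGMA b:Field l. Pow (underS l b)| \<le>o |Field l|"
    using card_of_bounded_subsets[OF assms(2) l_inf ordIso_imp_ordLeq[OF assms(6)]]
      card_of_Field_ordIso[OF assms(2)] ordIso_symmetric ordLeq_ordIso_trans by blast
  moreover have "(SIGMA b:Field l. Pow (underS l b)) \<noteq> {}"
    using l_inf by (auto simp: cinfinite_def Sigma_empty_iff dest: infinite_imp_nonempty)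
  \<comment> \<open>Surjectivity of the coding suffices; a pair may have several codes.\<close>
  ultimately obtain c where c: "c ` Field l = (SIGMA b:Field l. Pow (underS l b))"
    using card_of_ordLeq2[of "SIGMA b:Field l. Pow (underS l b)" "Field l"] by auto

  \<comment> \<open>The level is kept as first component, so that \<open>fst (c z)\<close> recovers
    it from a code \<open>z\<close>.\<close>
  define seg where "seg f b = (b, {a \<in> underS l b. f a})" for f :: "'l \<Rightarrow> bool" and b
  define A where "A f = {x. \<forall>g. (g, d x) \<in> l - Id \<longrightarrow>
    (\<exists>z\<in>x. \<exists>b. (g, b) \<in> l - Id \<and> c z = seg f b)}" for f
  have A: "eventually (\<lambda>x. x \<in> A f) U" for f
  proof (rule ccontr)
    assume "\<not> eventually (\<lambda>x. x \<in> A f) U"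
    then have "eventually (\<lambda>x. x \<notin> A f) U" using ultrafilter_on_dichotomy[OF assms(7)] by blast
    then have "eventually (\<lambda>x. \<exists>g. (g, d x) \<in> l - Id \<and>
        (\<forall>z\<in>x. \<forall>b. (g, b) \<in> l - Id \<longrightarrow> c z \<noteq> seg f b)) U"
      by (rule eventually_mono) (auto simp: A_def)
    \<comment> \<open>\<open>h x\<close> is a level below \<open>d x\<close> beyond which
      \<open>x\<close> has no code for \<open>f\<close>. Minimality of \<open>d\<close> bounds
      \<open>h\<close> by a constant \<open>a\<close>, but by fineness almost every \<open>x\<close>
      contains a code at a level \<open>a'\<close> above \<open>a\<close>.\<close>
    then obtain h where h: "eventually (\<lambda>x. (h x, d x) \<in> l - Id \<and>
        (\<forall>z\<in>x. \<forall>b. (h x, b) \<in> l - Id \<longrightarrow> c z \<noteq> seg f b)) U"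
      unfolding eventually_ex by blast
    then obtain a where a: "a \<in> Field l" "eventually (\<lambda>x. (h x, a) \<in> l) U"
    proof -
      from h have "eventually (\<lambda>x. (h x, d x) \<in> l - Id) U" by (rule eventually_mono) blast
      from d_min[OF this] show ?thesis using that by blast
    qed
    obtain a' where a': "a' \<in> Field l" "a \<noteq> a'" "(a, a') \<in> l"
      using infinite_Card_order_limit[OF assms(2)] l_inf a(1) unfolding cinfinite_def by blast
    have "seg f a' \<in> c ` Field l" using a'(1) by (auto simp: c seg_def)
    then obtain z where z: "z \<in> Field l" "c z = seg f a'" by force
    have "eventually (\<lambda>x. False) U"
      using h a(2) fine[OF z(1)]
    proof eventually_elim
      case (elim x)
      then have "(h x, a') \<in> l - Id" using Well_order_strict_trans[OF wo] a' by blast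
      then show False using elim z(2) by blast
    qed
    then show False using U(1) by (simp add: trivial_limit_def)
  qed

  obtain I where I: "I \<subseteq> Field (ctwo ^c l)" "|I| =o k" "eventually (\<lambda>x. x \<in> (\<Inter>i\<in>I. A i)) U"
    using gal A unfolding Gal_def by blast
  \<comment> \<open>Members of \<open>Func\<close> agree outside \<open>Field l\<close>, so distinct
    ones differ inside it.\<close>
  have "\<exists>a\<in>Field l. f a \<noteq> g a" if "f \<in> I" "g \<in> I" "f \<noteq> g" for f g
  proof -
    have "f \<in> Func (Field l) UNIV" "g \<in> Func (Field l) UNIV"
      using that(1,2) I(1) by (auto simp: cexp_def ctwo_def Field_card_of)
    moreover obtain a where "f a \<noteq> g a" using \<open>f \<noteq> g\<close> by blast
    ultimately show ?thesis unfolding Func_def by (cases "a \<in> Field l") auto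
  qed
  then obtain s where s: "\<And>f g. f \<in> I \<Longrightarrow> g \<in> I \<Longrightarrow> f \<noteq> g \<Longrightarrow> s f g \<in> Field l \<and> f (s f g) \<noteq> g (s f g)"
    by metis
  \<comment> \<open>One chosen point of difference per pair: at most \<open>k\<close> many points,
    so a single level \<open>b\<close> lies above all of them.\<close>
  let ?S = "(\<lambda>(f, g). s f g) ` {(f, g) \<in> I \<times> I. f \<noteq> g}"
  have "infinite I"
    using card_of_ordIso_finite_Field[OF assms(1) ordIso_symmetric[OF I(2)]] k_inf
    unfolding cinfinite_def by blast
  have "|?S| \<le>o |I \<times> I|"
    by (rule ordLeq_transitive[OF card_of_image]) (auto intro: card_of_mono1)
  moreover have "|I \<times> I| =o |I|" using \<open>infinite I\<close> by (rule card_of_Times_same_infinite)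
  ultimately have "|?S| \<le>o |I|" by (rule ordLeq_ordIso_trans)
  then have "|?S| <o cofinality l"
    using I(2) assms(5) by (rule ordLeq_ordLess_trans[OF ordLeq_ordIso_trans])
  moreover have "?S \<subseteq> Field l" using s by auto
  ultimately obtain b where b: "b \<in> Field l" "\<forall>a\<in>?S. (a, b) \<in> l - Id"
    using ordLess_cofinality_bounded[OF assms(2) l_inf] by meson
  have "eventually (\<lambda>x. x \<in> P_card k l \<and> (b, d x) \<in> l - Id \<and> (\<forall>f\<in>I. x \<in> A f)) U"
    using U(2) d[OF b(1)] I(3) by eventually_elim blast
  then obtain x where x: "x \<in> P_card k l" "(b, d x) \<in> l - Id" "\<And>f. f \<in> I \<Longrightarrow> x \<in> A f"
    using eventually_happens[of _ U] U(1) by blast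

  have "inj_on (\<lambda>f. {z \<in> x. c z = seg f (fst (c z))}) I"
  proof (rule inj_onI, rule ccontr)
    fix f g assume fg: "f \<in> I" "g \<in> I" "f \<noteq> g"
      and eq: "{z \<in> x. c z = seg f (fst (c z))} = {z \<in> x. c z = seg g (fst (c z))}"
    have "(s f g, b) \<in> l" using b(2) fg by blast
    then have "(s f g, d x) \<in> l - Id" using Well_order_strict_trans[OF wo] x(2) by blast
    \<comment> \<open>The level \<open>a\<close> is strictly above \<open>s f g\<close>, so a common
      segment at \<open>a\<close> would force agreement at \<open>s f g\<close>.\<close>
    then obtain z a where z: "z \<in> x" "(s f g, a) \<in> l - Id" "c z = seg f a"
      using x(3)[OF fg(1)] unfolding A_def by blast
    then have "z \<in> {z \<in> x. c z = seg f (fst (c z))}" by (simp add: seg_def)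
    then have "seg f a = seg g a" unfolding eq using z(3) by (simp add: seg_def)
    then have "f (s f g) = g (s f g)" using z(2) by (auto simp: seg_def underS_def)
    then show False using s[OF fg] by blast
  qed
  \<comment> \<open>Thus \<open>k\<close> many functions inject into the fewer than \<open>k\<close>
    subsets of \<open>x\<close>.\<close>
  then have "|I| \<le>o |Pow x|" by (rule card_of_ordLeqI) auto
  moreover have "|Pow x| <o k"
    using strong_limit_card_of_Pow[OF assms(4)] x(1) unfolding P_card_def by blast
  ultimately have "|I| <o k" by (rule ordLeq_ordLess_trans)
  then show False using I(2) not_ordLess_ordIso by blast
qed

end
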